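(* Let $k\ge1$ be an integer. We have $$G^{(k-1)(k-2)\cdots1k}_{2\text{-}31}(x)=x^kC^2(x),$$ where $C^2(x)=(C(x))^2$. Hence $$N^{(k-1)(k-2)\cdots1k}_{2\text{-}31}(n)=\begin{cases}C_{n-(k-1)},&\text{if }n\ge k,\\0,&\text{otherwise.}\end{cases}$$
   Context: A permutation $\pi=\pi_1\cdots\pi_n$ of $\{1,\dots,n\}$ contains the generalized pattern $2\text{-}31$ if there are indices $i<j<n$ such that $\pi_i\pi_j\pi_{j+1}$ is order-isomorphic to $231$; otherwise it avoids it. A permutation $\pi$ begins with a pattern $p=p_1\cdots p_k$ if $n\ge k$ and $\pi_1\cdots\pi_k$ is order-isomorphic to $p$; in addition, by convention, the empty permutation is assumed to begin with the pattern $1$. The pattern $(k-1)(k-2)\cdots1k$ consists of $k-1,k-2,\dots,1$ in decreasing order followed by $k$ (for $k=1$ it is $1$, for $k=2$ it is $12$). $N^p_q(n)$ is the number of permutations of $\{1,\dots,n\}$ that avoid $q$ and begin with $p$, and $G^p_q(x)=\sum_{n\ge0}N^p_q(n)x^n$ is the ordinary generating function. $C(x)=\sum_{n\ge0}C_nx^n=\frac{1-\sqrt{1-4x}}{2x}$, with $C_n=\frac1{n+1}\binom{2n}{n}$ the Catalan numbers.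
   Formalization: For k=1 the convention that the empty permutation begins with 1 gives N(0)=1, not 0, so 1 is added to G and to N(0) when k=1; the printed formulas are also proved for all k≥1 without that convention. *)

theory Defs
  imports
    "HOL-Combinatorics.Multiset_Permutations"
    "HOL-Computational_Algebra.Formal_Power_Series"
begin

text \<open>
  A permutation of \<open>{1..n}\<close> is represented by its one-line word, that is, by an element of
  \<^term>\<open>permutations_of_set {1..n::nat}\<close>. List positions count from \<open>0\<close>, values from \<open>1\<close>.
\<close>

definition order_isomorphic :: "nat list \<Rightarrow> nat list \<Rightarrow> bool" where
  "order_isomorphic xs ys \<longleftrightarrow> length xs = length ys \<and>
     (\<forall>i<length xs. \<forall>j<length xs. xs ! i < xs ! j \<longleftrightarrow> ys ! i < ys ! j)"

definition contains_2_31 :: "nat list \<Rightarrow> bool" where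
  "contains_2_31 w \<longleftrightarrow> (\<exists>i j. i < j \<and> j + 1 < length w \<and>
     order_isomorphic [w ! i, w ! j, w ! (j + 1)] [2, 3, 1])"

definition avoiders_2_31 :: "nat \<Rightarrow> nat list set" where
  "avoiders_2_31 n = {w \<in> permutations_of_set {1..n}. \<not> contains_2_31 w}"

definition prefix_has_pattern :: "nat list \<Rightarrow> nat list \<Rightarrow> bool" where
  "prefix_has_pattern w p \<longleftrightarrow> length p \<le> length w \<and> order_isomorphic (take (length p) w) p"

text \<open>
  By convention the empty permutation begins with the pattern \<open>1\<close>, although it has no prefix
  of length \<open>1\<close>. This is the only difference between the next relation and the previous one.
\<close>

definition begins_with :: "nat list \<Rightarrow> nat list \<Rightarrow> bool" where
  "begins_with w p \<longleftrightarrow> prefix_has_pattern w p \<or> (w = [] \<and> p = [1])"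

definition N_2_31 :: "nat list \<Rightarrow> nat \<Rightarrow> nat" where
  "N_2_31 p n = card {w \<in> avoiders_2_31 n. begins_with w p}"

definition G_2_31 :: "nat list \<Rightarrow> real fps" where
  "G_2_31 p = Abs_fps (\<lambda>n. real (N_2_31 p n))"

text \<open>The same counts without the convention on the empty permutation.\<close>

definition N0_2_31 :: "nat list \<Rightarrow> nat \<Rightarrow> nat" where
  "N0_2_31 p n = card {w \<in> avoiders_2_31 n. prefix_has_pattern w p}"

definition G0_2_31 :: "nat list \<Rightarrow> real fps" where
  "G0_2_31 p = Abs_fps (\<lambda>n. real (N0_2_31 p n))"

text \<open>The pattern \<open>(k-1)(k-2)\<dots>1k\<close>.\<close>

definition decreasing_then_max :: "nat \<Rightarrow> nat list" where
  "decreasing_then_max k = rev [1..<k] @ [k]"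

definition catalan :: "nat \<Rightarrow> real" where
  "catalan n = 1 / (real n + 1) * real ((2 * n) choose n)"

definition catalan_fps :: "real fps" where
  "catalan_fps = Abs_fps catalan"

end

theory Submission
  imports Defs
begin

text \<open>
  A word avoids 2-31 iff for every entry \<open>m\<close> no later descent jumps over \<open>m\<close>, that is, iff among the
  entries to the right of \<open>m\<close> all smaller ones precede all larger ones. Splitting off the first
  entry gives the Catalan recurrence for the number of avoiders of an interval. If an avoider starts
  with \<open>m = \<pi>\<^sub>1 > \<dots> > \<pi>\<^sub>k\<^sub>-\<^sub>1\<close> and \<open>\<pi>\<^sub>k > m\<close>, then every value below \<open>m\<close> must already have occurred
  before \<open>\<pi>\<^sub>k\<close>, so the word is \<open>k - 1, \<dots>, 1\<close> followed by an arbitrary nonempty avoider of \<open>{k..n}\<close>.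
\<close>

section \<open>The Catalan generating function\<close>

lemma catalan_0: "catalan 0 = 1"
  by (simp add: catalan_def)

text \<open>Two absorption identities lead from 2n+2 over n+1 via 2n+1 over n down to 2n over n.
  This first-order recurrence is the coefficient form of the differential equation for the square
  root of 1 - 4x.\<close>

lemma catalan_Suc: "(real n + 2) * catalan (Suc n) = 2 * (2 * real n + 1) * catalan n"
proof -
  have 1: "Suc n * (Suc (Suc (2 * n)) choose Suc n) = Suc (Suc (2 * n)) * (Suc (2 * n) choose n)"
    by (rule Suc_times_binomial)
  have 2: "Suc n * (Suc (2 * n) choose n) = Suc (2 * n) * (2 * n choose n)"
    using binomial_absorb_comp[of "Suc (2 * n)" n] by (simp add: Suc_diff_le)
  have r1: "(real n + 1) * real (2 * Suc n choose Suc n)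
      = (2 * real n + 2) * real (Suc (2 * n) choose n)"
    using arg_cong[OF 1, of real] by (simp add: algebra_simps)
  have r2: "(real n + 1) * real (Suc (2 * n) choose n)
      = (2 * real n + 1) * real (2 * n choose n)"
    using arg_cong[OF 2, of real] by (simp add: algebra_simps)
  have "(real n + 1) * real (2 * Suc n choose Suc n)
      = 2 * ((real n + 1) * real (Suc (2 * n) choose n))"
    using r1 by (simp add: algebra_simps)
  then have 3: "(real n + 1) * real (2 * Suc n choose Suc n)
      = 2 * ((2 * real n + 1) * real (2 * n choose n))"
    by (simp only: r2)
  have "(real n + 2) * catalan (Suc n) = real (2 * Suc n choose Suc n)"
    by (simp add: catalan_def add.commute del: mult_Suc_right)
  also have "\<dots> = 2 * (2 * real n + 1) * catalan n"
    using 3 by (simp add: catalan_def field_simps del: mult_Suc_right)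
  finally show ?thesis .
qed

text \<open>Comparing coefficients gives (n+1) g_(n+1) = 4 (n-1) g_n. The factor n-1 vanishes at n =
  1, so g_2 and all later coefficients are 0.\<close>

lemma fps_eq_if_ode:
  fixes G :: "real fps"
  assumes "(1 - 4 * fps_X) * fps_deriv G = - 4 * G" and "fps_nth G 0 = 1"
  shows "G = 1 - 4 * fps_X"
proof -
  have "fps_nth ((1 - 4 * fps_X) * fps_deriv G) n = fps_nth (- 4 * G) n" for n
    using assms(1) by simp
  then have rec: "fps_nth (fps_deriv G) n - 4 * fps_nth (fps_X * fps_deriv G) n = - 4 * fps_nth G n"
    for n
    by (simp add: algebra_simps fps_numeral_fps_const)
  have G1: "fps_nth G (Suc 0) = - 4"
    using rec[of 0] assms(2) by simp
  have G2: "fps_nth G (Suc (Suc n)) = 0" for n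
  proof (induction n)
    case 0
    then show ?case using rec[of 1] G1 by simp
  next
    case (Suc n)
    then show ?case using rec[of "Suc (Suc n)"] by simp
  qed
  have "fps_nth G n = fps_nth (1 - 4 * fps_X) n" for n
    using assms(2) G1 G2
    by (cases n rule: nat.exhaust; cases "n - 1") (auto simp: fps_numeral_fps_const)
  then show ?thesis by (simp add: fps_eq_iff)
qed

lemma catalan_fps_eq: "catalan_fps = 1 + fps_X * catalan_fps ^ 2"
proof -
  \<comment> \<open>\<open>F\<close> is the square root of \<open>1 - 4x\<close>; this is shown through the differential equation it satisfies.\<close>
  define F where "F = 1 - 2 * fps_X * catalan_fps"
  \<comment> \<open>The coefficient of x^(m+1) in \<open>F\<close> is -2 times
    \<open>catalan m\<close>, so at x^(m+1) the equation is \<open>catalan_Suc\<close> for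
    m.\<close>
  have ode: "(1 - 4 * fps_X) * fps_deriv F = - 2 * F"
  proof (rule fps_ext)
    fix n
    show "fps_nth ((1 - 4 * fps_X) * fps_deriv F) n = fps_nth (- 2 * F) n"
    proof (cases n)
      case 0
      then show ?thesis
        by (simp add: F_def algebra_simps fps_numeral_fps_const catalan_fps_def catalan_0)
    next
      case (Suc m)
      then show ?thesis
        using catalan_Suc[of m] catalan_Suc[of 0]
        by (simp add: F_def algebra_simps fps_numeral_fps_const catalan_fps_def)
    qed
  qed
  have "(1 - 4 * fps_X) * fps_deriv (F ^ 2) = 2 * F * ((1 - 4 * fps_X) * fps_deriv F)"
    by (simp add: power2_eq_square algebra_simps)
  also have "\<dots> = - 4 * F ^ 2"
    unfolding ode by (simp add: power2_eq_square algebra_simps)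
  finally have "F ^ 2 = 1 - 4 * fps_X"
    by (rule fps_eq_if_ode) (simp add: F_def power2_eq_square)
  \<comment> \<open>Expanding the square turns the equation into the desired one multiplied by 4x;
    this factor cancels since power series over the reals have no zero divisors.\<close>
  then have "4 * fps_X * (catalan_fps - (1 + fps_X * catalan_fps ^ 2)) = 0"
    by (simp add: F_def power2_eq_square algebra_simps)
  then show ?thesis by simp
qed

lemma catalan_convolution: "catalan (Suc n) = (\<Sum>i\<le>n. catalan i * catalan (n - i))"
proof -
  have "catalan (Suc n) = fps_nth catalan_fps (Suc n)"
    by (simp add: catalan_fps_def)
  also have "\<dots> = fps_nth (catalan_fps ^ 2) n"
    by (subst catalan_fps_eq) simp
  also have "\<dots> = (\<Sum>i\<le>n. catalan i * catalan (n - i))"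
    by (simp add: power2_eq_square fps_mult_nth catalan_fps_def atLeast0AtMost)
  finally show ?thesis .
qed

section \<open>Words avoiding 2-31\<close>

lemma contains_2_31_iff:
  "contains_2_31 w \<longleftrightarrow>
    (\<exists>i j. i < j \<and> j + 1 < length w \<and> w ! (j + 1) < w ! i \<and> w ! i < w ! j)"
proof -
  have "order_isomorphic [a, b, c] [2, 3, 1] \<longleftrightarrow> c < a \<and> a < b" for a b c
    by (auto simp: order_isomorphic_def All_less_Suc numeral_2_eq_2 numeral_3_eq_3)
  then show ?thesis unfolding contains_2_31_def by blast
qed

text \<open>Such an adjacent pair plays the 31 of an occurrence whose 2 is a letter \<open>m\<close>
  standing before \<open>u\<close>. Keeping \<open>m\<close> apart from the word allows recursion on
  the first letter.\<close>

definition descent_over :: "nat \<Rightarrow> nat list \<Rightarrow> bool" where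
  "descent_over m u \<longleftrightarrow> (\<exists>j. j + 1 < length u \<and> u ! (j + 1) < m \<and> m < u ! j)"

lemma contains_2_31_Nil: "\<not> contains_2_31 []"
  by (simp add: contains_2_31_def)

text \<open>The first letter can only play the 2 of an occurrence, because the 3 and the 1 come
  later; otherwise the occurrence lies inside \<open>u\<close>.\<close>

lemma contains_2_31_Cons: "contains_2_31 (m # u) \<longleftrightarrow> descent_over m u \<or> contains_2_31 u"
proof
  assume "contains_2_31 (m # u)"
  then obtain i j where ij: "i < j" "j + 1 < length (m # u)"
    "(m # u) ! (j + 1) < (m # u) ! i" "(m # u) ! i < (m # u) ! j"
    unfolding contains_2_31_iff by blast
  obtain j' where j: "j = Suc j'" using ij(1) by (cases j) auto
  show "descent_over m u \<or> contains_2_31 u"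
  proof (cases i)
    case 0
    then show ?thesis using ij j by (auto simp: descent_over_def)
  next
    case (Suc i')
    then have "i' < j' \<and> j' + 1 < length u \<and> u ! (j' + 1) < u ! i' \<and> u ! i' < u ! j'"
      using ij j by simp
    then show ?thesis unfolding contains_2_31_iff by blast
  qed
next
  assume "descent_over m u \<or> contains_2_31 u"
  then show "contains_2_31 (m # u)"
  proof
    assume "descent_over m u"
    then obtain j where "j + 1 < length u" "u ! (j + 1) < m" "m < u ! j"
      by (auto simp: descent_over_def)
    then show ?thesis
      unfolding contains_2_31_iff
      by (intro exI[of _ 0] exI[of _ "Suc j"]) simp
  next
    assume "contains_2_31 u"
    then obtain i j where "i < j" "j + 1 < length u" "u ! (j + 1) < u ! i" "u ! i < u ! j"
      unfolding contains_2_31_iff by blast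
    then show ?thesis
      unfolding contains_2_31_iff
      by (intro exI[of _ "Suc i"] exI[of _ "Suc j"]) simp
  qed
qed

lemma descent_over_Cons:
  "descent_over m (x # u) \<longleftrightarrow> (m < x \<and> u \<noteq> [] \<and> hd u < m) \<or> descent_over m u"
proof
  assume "descent_over m (x # u)"
  then obtain j where "j + 1 < length (x # u)" "(x # u) ! (j + 1) < m" "m < (x # u) ! j"
    by (auto simp: descent_over_def)
  then show "(m < x \<and> u \<noteq> [] \<and> hd u < m) \<or> descent_over m u"
    by (cases j) (auto simp: descent_over_def hd_conv_nth)
next
  assume "(m < x \<and> u \<noteq> [] \<and> hd u < m) \<or> descent_over m u"
  then show "descent_over m (x # u)"
  proof
    assume "m < x \<and> u \<noteq> [] \<and> hd u < m"
    then show ?thesis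
      unfolding descent_over_def by (intro exI[of _ 0]) (auto simp: hd_conv_nth)
  next
    assume "descent_over m u"
    then obtain j where "j + 1 < length u" "u ! (j + 1) < m" "m < u ! j"
      by (auto simp: descent_over_def)
    then show ?thesis
      unfolding descent_over_def by (intro exI[of _ "Suc j"]) simp
  qed
qed

text \<open>The word crosses the level \<open>m\<close> at most once, at the junction, and does so
  upwards.\<close>

lemma not_descent_over_append:
  assumes "\<forall>x\<in>set L. x < m" and "\<forall>x\<in>set R. m < x"
  shows "\<not> descent_over m (L @ R)"
  using assms(1)
proof (induction L)
  case Nil
  have "\<not> (j + 1 < length R \<and> R ! (j + 1) < m)" for j
    using assms(2) by (meson less_asym nth_mem)
  then show ?case by (auto simp: descent_over_def)
qed (auto simp: descent_over_Cons)

text \<open>Converse of the previous lemma: once the word has risen above \<open>m\<close> it cannot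
  come back below, and no letter equals \<open>m\<close>.\<close>

lemma not_descent_over_split:
  assumes "\<not> descent_over m u" and "m \<notin> set u"
  obtains L R where "u = L @ R" "\<forall>x\<in>set L. x < m" "\<forall>x\<in>set R. m < x"
  using assms
proof (induction u arbitrary: thesis)
  case Nil
  then show ?case by simp
next
  case (Cons x u)
  then obtain L R where LR: "u = L @ R" "\<forall>x\<in>set L. x < m" "\<forall>x\<in>set R. m < x"
    by (auto simp: descent_over_Cons)
  show ?case
  proof (cases "x < m")
    case True
    then show ?thesis using LR Cons.prems(1)[of "x # L" R] by simp
  next
    case False
    then have "m < x" using Cons.prems by auto
    \<comment> \<open>Otherwise the first letter of \<open>L\<close> would stand right after
      \<open>x\<close>, forming a descent over \<open>m\<close>.\<close>
    then have "L = []"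
      using LR Cons.prems(2) by (cases L) (auto simp: descent_over_Cons)
    then show ?thesis using LR \<open>m < x\<close> Cons.prems(1)[of "[]" "x # R"] by simp
  qed
qed

text \<open>No occurrence straddles the cut: if its 2 lies in \<open>L\<close>, so does the smaller
  1, and hence the 3 just before it; if its 2 lies in \<open>R\<close>, so does everything after
  it.\<close>

lemma not_contains_2_31_append:
  assumes "\<forall>x\<in>set L. \<forall>y\<in>set R. x < y"
  shows "\<not> contains_2_31 (L @ R) \<longleftrightarrow> \<not> contains_2_31 L \<and> \<not> contains_2_31 R"
  using assms
proof (induction L)
  case Nil
  then show ?case by (simp add: contains_2_31_Nil)
next
  case (Cons x L)
  \<comment> \<open>Every letter of \<open>R\<close> exceeds \<open>x\<close> and every letter of
    \<open>L\<close>, so neither \<open>R\<close> nor the junction contributes a descent over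
    \<open>x\<close>.\<close>
  have "descent_over x (L @ R) \<longleftrightarrow> descent_over x L"
    using Cons.prems
  proof (induction L)
    case Nil
    then show ?case using not_descent_over_append[of "[]" x R] by (simp add: descent_over_def)
  next
    case (Cons y L)
    then show ?case by (cases L; cases R) (auto simp: descent_over_Cons)
  qed
  then show ?case using Cons by (auto simp: contains_2_31_Cons)
qed

section \<open>Counting avoiders of an interval\<close>

text \<open>Arbitrary value sets are allowed so that the blocks of a decomposed word need no
  relabelling.\<close>

definition avoiders_on :: "nat set \<Rightarrow> nat list set" where
  "avoiders_on A = {w \<in> permutations_of_set A. \<not> contains_2_31 w}"

lemma in_avoiders_on_iff:
  "w \<in> avoiders_on A \<longleftrightarrow> set w = A \<and> distinct w \<and> \<not> contains_2_31 w"
  by (auto simp: avoiders_on_def permutations_of_set_def)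

lemma finite_avoiders_on: "finite (avoiders_on A)"
  by (simp add: avoiders_on_def)

text \<open>Having no descent over \<open>m\<close> forces the smaller letters to precede the larger
  ones; the two blocks then avoid the pattern independently. This is the Catalan
  decomposition.\<close>

lemma in_avoiders_on_Cons_iff:
  "m # u \<in> avoiders_on A \<longleftrightarrow>
    m \<in> A \<and> (\<exists>L R. u = L @ R \<and> L \<in> avoiders_on {x\<in>A. x < m} \<and> R \<in> avoiders_on {x\<in>A. m < x})"
proof
  assume A: "m # u \<in> avoiders_on A"
  then have u: "\<not> descent_over m u" "m \<notin> set u" "\<not> contains_2_31 u" "distinct u"
    "A = insert m (set u)"
    by (auto simp: in_avoiders_on_iff contains_2_31_Cons)
  from not_descent_over_split[OF u(1,2)] obtain L R where
    LR: "u = L @ R" "\<forall>x\<in>set L. x < m" "\<forall>x\<in>set R. m < x" .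
  have "\<forall>x\<in>set L. \<forall>y\<in>set R. x < y" using LR by (auto intro: less_trans)
  then have "\<not> contains_2_31 L" "\<not> contains_2_31 R"
    using u(3) LR(1) not_contains_2_31_append[of L R] by simp_all
  moreover have "set L = {x\<in>A. x < m}" "set R = {x\<in>A. m < x}"
    using u(5) LR by auto
  moreover have "distinct L" "distinct R" using u(4) LR(1) by simp_all
  ultimately have "L \<in> avoiders_on {x\<in>A. x < m}" "R \<in> avoiders_on {x\<in>A. m < x}"
    by (simp_all add: in_avoiders_on_iff)
  then show "m \<in> A \<and> (\<exists>L R. u = L @ R \<and> L \<in> avoiders_on {x\<in>A. x < m} \<and>
      R \<in> avoiders_on {x\<in>A. m < x})"
    using u(5) LR(1) by blast
next
  assume "m \<in> A \<and> (\<exists>L R. u = L @ R \<and> L \<in> avoiders_on {x\<in>A. x < m} \<and>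
      R \<in> avoiders_on {x\<in>A. m < x})"
  then obtain L R where LR: "m \<in> A" "u = L @ R" "L \<in> avoiders_on {x\<in>A. x < m}"
    "R \<in> avoiders_on {x\<in>A. m < x}" by blast
  have "\<not> descent_over m (L @ R)"
    using LR by (intro not_descent_over_append) (auto simp: in_avoiders_on_iff)
  moreover have "\<not> contains_2_31 (L @ R)"
    using LR by (subst not_contains_2_31_append) (auto simp: in_avoiders_on_iff)
  moreover have "set L = {x\<in>A. x < m}" "set R = {x\<in>A. m < x}" "distinct L" "distinct R"
    using LR by (simp_all add: in_avoiders_on_iff)
  moreover have "insert m ({x\<in>A. x < m} \<union> {x\<in>A. m < x}) = A"
    using LR(1) by force
  moreover have "{x\<in>A. x < m} \<inter> {x\<in>A. m < x} = {}" by force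
  ultimately show "m # u \<in> avoiders_on A"
    using LR(2) by (simp add: in_avoiders_on_iff contains_2_31_Cons)
qed

text \<open>The left end \<open>a\<close> is kept arbitrary in the induction because the upper block
  starts at \<open>Suc (a + i)\<close>.\<close>

lemma card_avoiders_on: "real (card (avoiders_on {a..<a + n})) = catalan n"
proof (induction n arbitrary: a rule: less_induct)
  case (less n)
  show ?case
  proof (cases n)
    case 0
    have "avoiders_on {} = {[]}"
      by (auto simp: in_avoiders_on_iff contains_2_31_Nil)
    then show ?thesis using 0 by (simp add: catalan_0)
  next
    case (Suc l)
    \<comment> \<open>\<open>B i\<close> will be the class of avoiders with first letter
      \<open>a + i\<close>.\<close>
    define B where "B i = (\<lambda>(L, R). (a + i) # L @ R) `
      (avoiders_on {a..<a + i} \<times> avoiders_on {Suc (a + i)..<a + n})" for i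
    have below: "{x \<in> {a..<a + n}. x < a + i} = {a..<a + i}" if "i \<le> l" for i
      using that Suc by auto
    have above: "{x \<in> {a..<a + n}. a + i < x} = {Suc (a + i)..<a + n}" for i
      by auto
    have dec: "avoiders_on {a..<a + n} = (\<Union>i\<le>l. B i)"
    proof (intro equalityI subsetI)
      fix w assume w: "w \<in> avoiders_on {a..<a + n}"
      then obtain m u where mu: "w = m # u"
        using Suc by (cases w) (auto simp: in_avoiders_on_iff)
      with w have "m \<in> {a..<a + n}" by (auto simp: in_avoiders_on_iff)
      then obtain i where i: "m = a + i" "i \<le> l"
        using Suc by (auto dest!: le_Suc_ex)
      have "(a + i) # u \<in> avoiders_on {a..<a + n}" using w mu i by simp
      then obtain L R where LR: "u = L @ R" "L \<in> avoiders_on {a..<a + i}"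
        "R \<in> avoiders_on {Suc (a + i)..<a + n}"
        unfolding in_avoiders_on_Cons_iff below[OF i(2)] above by blast
      then have "w = (\<lambda>(L, R). (a + i) # L @ R) (L, R)" using mu i by simp
      then have "w \<in> B i" unfolding B_def using LR by blast
      then show "w \<in> (\<Union>i\<le>l. B i)" using i(2) by blast
    next
      fix w assume "w \<in> (\<Union>i\<le>l. B i)"
      then obtain i L R where i: "i \<le> l" and w: "w = (a + i) # L @ R"
        and LR: "L \<in> avoiders_on {a..<a + i}" "R \<in> avoiders_on {Suc (a + i)..<a + n}"
        unfolding B_def by auto
      have "a + i \<in> {a..<a + n}" using i Suc by simp
      then show "w \<in> avoiders_on {a..<a + n}"
        unfolding w in_avoiders_on_Cons_iff below[OF i] above using LR by blast
    qed
    have card_B: "real (card (B i)) = catalan i * catalan (l - i)" if "i \<le> l" for i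
    proof -
      have "inj_on (\<lambda>(L, R). (a + i) # L @ R)
        (avoiders_on {a..<a + i} \<times> avoiders_on {Suc (a + i)..<a + n})"
      proof (rule inj_onI, clarsimp)
        fix L R L' R'
        assume L: "L \<in> avoiders_on {a..<a + i}" "L' \<in> avoiders_on {a..<a + i}"
          and eq: "L @ R = L' @ R'"
        \<comment> \<open>The cut can be recovered from the word: the length of the lower block is
          the size of its value set.\<close>
        have "length L = length L'"
          using L by (metis distinct_card in_avoiders_on_iff)
        then show "L = L' \<and> R = R'" using eq by simp
      qed
      then have "card (B i) =
        card (avoiders_on {a..<a + i}) * card (avoiders_on {Suc (a + i)..<a + n})"
        unfolding B_def by (simp add: card_image card_cartesian_product)
      moreover have "{Suc (a + i)..<a + n} = {Suc (a + i)..<Suc (a + i) + (l - i)}"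
        using Suc that by auto
      ultimately show ?thesis
        using less.IH[of i a] less.IH[of "l - i" "Suc (a + i)"] Suc that by simp
    qed
    have "card (avoiders_on {a..<a + n}) = (\<Sum>i\<le>l. card (B i))"
      unfolding dec by (intro card_UN_disjoint) (auto simp: B_def finite_avoiders_on)
    then have "real (card (avoiders_on {a..<a + n})) = (\<Sum>i\<le>l. catalan i * catalan (l - i))"
      using card_B by simp
    then show ?thesis using Suc catalan_convolution by simp
  qed
qed

section \<open>Avoiders beginning with the pattern\<close>

lemma length_decreasing_then_max: "k \<ge> 1 \<Longrightarrow> length (decreasing_then_max k) = k"
  by (simp add: decreasing_then_max_def)

lemma nth_decreasing_then_max:
  assumes "i < k"
  shows "decreasing_then_max k ! i = (if i = k - 1 then k else k - 1 - i)"
  using assms by (auto simp: decreasing_then_max_def nth_append rev_nth)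

text \<open>All order relations of the pattern are captured by its first k - 1 letters decreasing
  and its last letter exceeding them. For k = 1 the block \<open>q\<close> is empty.\<close>

lemma order_isomorphic_decreasing_then_max_iff:
  assumes "k \<ge> 1"
  shows "order_isomorphic p (decreasing_then_max k) \<longleftrightarrow>
    (\<exists>q b. p = q @ [b] \<and> length q = k - 1 \<and> sorted_wrt (>) q \<and> (\<forall>x\<in>set q. x < b))"
proof
  assume iso: "order_isomorphic p (decreasing_then_max k)"
  then have len: "length p = k"
    using assms by (simp add: order_isomorphic_def length_decreasing_then_max)
  have *: "p ! i < p ! j \<longleftrightarrow> decreasing_then_max k ! i < decreasing_then_max k ! j"
    if "i < k" "j < k" for i j
    using iso that len by (simp add: order_isomorphic_def)
  obtain q b where p: "p = q @ [b]"
    using len assms by (cases p rule: rev_cases) auto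
  have lq: "length q = k - 1" using len p by simp
  have "sorted_wrt (>) q"
    unfolding sorted_wrt_iff_nth_less
  proof (intro allI impI)
    fix i j assume "i < j" "j < length q"
    then show "q ! i > q ! j"
      using *[of j i] lq by (auto simp: p nth_append nth_decreasing_then_max)
  qed
  moreover have "x < b" if "x \<in> set q" for x
  proof -
    from that obtain i where "i < length q" "x = q ! i" by (auto simp: in_set_conv_nth)
    then show ?thesis
      using *[of i "k - 1"] lq by (auto simp: p nth_append nth_decreasing_then_max)
  qed
  ultimately show "\<exists>q b. p = q @ [b] \<and> length q = k - 1 \<and> sorted_wrt (>) q \<and> (\<forall>x\<in>set q. x < b)"
    using p lq by blast
next
  assume "\<exists>q b. p = q @ [b] \<and> length q = k - 1 \<and> sorted_wrt (>) q \<and> (\<forall>x\<in>set q. x < b)"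
  then obtain q b where p: "p = q @ [b]" and lq: "length q = k - 1"
    and q: "sorted_wrt (>) q" and b: "\<forall>x\<in>set q. x < b" by blast
  have less_iff: "q ! i < q ! j \<longleftrightarrow> j < i" if "i < k - 1" "j < k - 1" for i j
    using q that lq unfolding sorted_wrt_iff_nth_less by (metis less_asym less_irrefl nat_neq_iff)
  have below_b: "q ! i < b" if "i < k - 1" for i
    using b lq that by simp
  show "order_isomorphic p (decreasing_then_max k)"
    unfolding order_isomorphic_def
  proof (intro conjI allI impI)
    show "length p = length (decreasing_then_max k)"
      using assms lq by (simp add: p length_decreasing_then_max)
    fix i j assume "i < length p" "j < length p"
    then have "i < k - 1 \<or> i = k - 1" "j < k - 1 \<or> j = k - 1"
      using lq by (auto simp: p)
    then show "p ! i < p ! j \<longleftrightarrow> decreasing_then_max k ! i < decreasing_then_max k ! j"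
      using assms lq below_b[of i] below_b[of j] less_iff[of i j]
      by (elim disjE) (auto simp: p nth_append nth_decreasing_then_max)
  qed
qed

lemma not_contains_2_31_rev_upt: "\<not> contains_2_31 (rev [1..<k])"
proof (induction k)
  case 0
  then show ?case by (simp add: contains_2_31_Nil)
next
  case (Suc k)
  then show ?case
    using not_descent_over_append[of "rev [1..<k]" k "[]"]
    by (cases k) (auto simp: contains_2_31_Nil contains_2_31_Cons)
qed

lemma sorted_wrt_greater_eq_rev_upt:
  fixes q :: "nat list"
  assumes "sorted_wrt (>) q" and "set q = {1..<k}"
  shows "q = rev [1..<k]"
proof -
  have "sorted_wrt (<) (rev q)" using assms(1) by (simp add: sorted_wrt_rev)
  then have "rev q = [1..<k]"
    using assms(2) by (intro sorted_distinct_set_unique) (auto simp: strict_sorted_iff)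
  then show ?thesis by (metis rev_rev_ident)
qed

text \<open>Let \<open>m\<close> be the first letter of a nonempty \<open>q\<close>. The rest of
  \<open>q\<close> lies below \<open>m\<close> and \<open>b\<close> lies above, so the cut between
  smaller and larger letters falls exactly before \<open>b\<close>. Hence \<open>q\<close> uses up
  all values up to \<open>m\<close>, in decreasing order.\<close>

lemma avoider_prefix_eq:
  assumes w: "q @ b # v \<in> avoiders_on {1..n}"
    and q: "sorted_wrt (>) q" and b: "\<forall>x\<in>set q. x < b"
  shows "q = rev [1..<Suc (length q)]"
proof (cases q)
  case Nil
  then show ?thesis by simp
next
  case (Cons m q')
  then obtain L R where m: "m \<in> {1..n}" and LR: "q' @ b # v = L @ R"
    "L \<in> avoiders_on {x\<in>{1..n}. x < m}" "R \<in> avoiders_on {x\<in>{1..n}. m < x}"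
    using w by (auto simp: in_avoiders_on_Cons_iff)
  have L: "set L = {1..<m}" "\<forall>x\<in>set R. m < x"
  proof -
    have "set L = {x\<in>{1..n}. x < m}" using LR(2) by (simp add: in_avoiders_on_iff)
    also have "\<dots> = {1..<m}" using m by auto
    finally show "set L = {1..<m}" .
    have "set R = {x\<in>{1..n}. m < x}" using LR(3) by (simp add: in_avoiders_on_iff)
    then show "\<forall>x\<in>set R. m < x" by blast
  qed
  have q': "\<forall>x\<in>set q'. x < m" "m < b" using q b Cons by simp_all
  obtain us where us: "q' = L @ us \<and> us @ b # v = R \<or> q' @ us = L \<and> b # v = us @ R"
    using LR(1) unfolding append_eq_append_conv2 by blast
  \<comment> \<open>\<open>us\<close> is the gap between the two cuts. Its first letter would have
    to lie both below and above \<open>m\<close>; in the second case that letter is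
    \<open>b\<close>.\<close>
  have "us = []"
  proof (rule ccontr)
    assume "us \<noteq> []"
    then obtain c us' where c: "us = c # us'" by (cases us) auto
    from us show False
    proof
      assume A: "q' = L @ us \<and> us @ b # v = R"
      then have "c \<in> set q'" "c \<in> set R" using c by auto
      then show False using L(2) q'(1) less_asym by blast
    next
      assume A: "q' @ us = L \<and> b # v = us @ R"
      then have "b \<in> set L" using c by auto
      then show False using L(1) q'(2) by simp
    qed
  qed
  then have "q' = L" using us by auto
  then have "set q = {1..<Suc m}" using L(1) m Cons by (simp add: atLeastLessThanSuc)
  then have eq: "q = rev [1..<Suc m]" using q by (rule sorted_wrt_greater_eq_rev_upt[rotated])
  then show ?thesis by (metis diff_Suc_1 length_rev length_upt)
qed

text \<open>The forced prefix takes the values below \<open>k\<close>. Any avoider of the remaining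
  values may follow, because the two blocks are separated in value and so create no new
  occurrence.\<close>

lemma avoiders_with_pattern_eq:
  assumes "1 \<le> k" and "k \<le> n"
  shows "{w \<in> avoiders_2_31 n. prefix_has_pattern w (decreasing_then_max k)} =
    (\<lambda>v. rev [1..<k] @ v) ` avoiders_on {k..n}"
proof (intro equalityI subsetI)
  fix w assume w: "w \<in> {w \<in> avoiders_2_31 n. prefix_has_pattern w (decreasing_then_max k)}"
  then obtain q b where q: "take k w = q @ [b]" "length q = k - 1" "sorted_wrt (>) q"
    "\<forall>x\<in>set q. x < b"
    using assms
    by (auto simp: prefix_has_pattern_def length_decreasing_then_max
        order_isomorphic_decreasing_then_max_iff)
  obtain v v' where v: "v = b # v'" and eq: "w = q @ v"
    using q(1) append_take_drop_id[of k w] by (metis append.assoc append_Cons append_Nil)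
  have wav: "w \<in> avoiders_on {1..n}"
    using w by (simp add: avoiders_2_31_def avoiders_on_def)
  have "q = rev [1..<Suc (length q)]"
    using wav q(3,4) unfolding eq v by (rule avoider_prefix_eq)
  then have qeq: "q = rev [1..<k]" using q(2) assms by simp
  have disj: "\<forall>x\<in>set q. x \<notin> set v" and un: "set q \<union> set v = {1..n}"
    using wav eq by (auto simp: in_avoiders_on_iff)
  have setq: "set q = {1..<k}" by (simp add: qeq)
  have "set v = {1..n} - set q" using disj un by blast
  also have "\<dots> = {k..n}" unfolding setq using assms by auto
  finally have setv: "set v = {k..n}" .
  have "\<not> contains_2_31 (q @ v)" using wav eq by (simp add: in_avoiders_on_iff)
  then have "\<not> contains_2_31 v"
    by (subst (asm) not_contains_2_31_append) (simp_all add: setq setv)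
  then have "v \<in> avoiders_on {k..n}"
    using wav eq setv by (simp add: in_avoiders_on_iff)
  then show "w \<in> (\<lambda>v. rev [1..<k] @ v) ` avoiders_on {k..n}"
    using eq qeq by blast
next
  fix w assume "w \<in> (\<lambda>v. rev [1..<k] @ v) ` avoiders_on {k..n}"
  then obtain v where v: "w = rev [1..<k] @ v" "set v = {k..n}" "distinct v" "\<not> contains_2_31 v"
    by (auto simp: in_avoiders_on_iff)
  \<comment> \<open>Since k is at most n, some value is left; the first letter of \<open>v\<close>
    plays the final maximum of the pattern.\<close>
  obtain b v' where bv: "v = b # v'" using v(2) assms by (cases v) auto
  have "\<not> contains_2_31 w"
    using v(2,4) not_contains_2_31_rev_upt[of k]
    unfolding v(1) by (subst not_contains_2_31_append) simp_all
  moreover have "{1..<k} \<union> {k..n} = {1..n}"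
    using assms by auto
  moreover have "{1..<k} \<inter> {k..n} = {}" by force
  ultimately have "w \<in> avoiders_2_31 n"
    using v(2,3) by (simp add: v(1) avoiders_2_31_def permutations_of_set_def)
  have "take k w = rev [1..<k] @ [b]"
    using assms by (cases k) (simp_all add: v(1) bv)
  moreover have "sorted_wrt (>) (rev [1..<k])"
    by (simp add: sorted_wrt_rev)
  moreover have "b \<in> {k..n}"
    unfolding v(2)[symmetric] bv by simp
  then have "\<forall>x\<in>set (rev [1..<k]). x < b"
    by simp
  ultimately have "order_isomorphic (take k w) (decreasing_then_max k)"
    unfolding order_isomorphic_decreasing_then_max_iff[OF assms(1)]
    by (intro exI[of _ "rev [1..<k]"] exI[of _ b]) simp
  moreover have "k \<le> length w" by (simp add: v(1) bv)
  ultimately show "w \<in> {w \<in> avoiders_2_31 n. prefix_has_pattern w (decreasing_then_max k)}"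
    using assms(1) \<open>w \<in> avoiders_2_31 n\<close>
    by (simp add: prefix_has_pattern_def length_decreasing_then_max)
qed

section \<open>Counts and generating functions, without and with the convention on the empty
  permutation\<close>

lemma N0_2_31_decreasing_then_max:
  assumes "k \<ge> 1"
  shows "real (N0_2_31 (decreasing_then_max k) n) =
    (if n \<ge> k then catalan (n - (k - 1)) else 0)"
proof (cases "n \<ge> k")
  case True
  have "N0_2_31 (decreasing_then_max k) n = card (avoiders_on {k..n})"
    unfolding N0_2_31_def avoiders_with_pattern_eq[OF assms True]
    by (intro card_image inj_onI) simp
  \<comment> \<open>The interval has n - k + 1 = n - (k - 1) values.\<close>
  also have "{k..n} = {k..<k + (n - (k - 1))}" using assms True by auto
  finally show ?thesis using True by (simp only: card_avoiders_on if_True)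
next
  case False
  have "length w = n" if "w \<in> avoiders_2_31 n" for w
    using that distinct_card[of w] by (auto simp: avoiders_2_31_def permutations_of_set_def)
  then have "{w \<in> avoiders_2_31 n. prefix_has_pattern w (decreasing_then_max k)} = {}"
    using False assms by (auto simp: prefix_has_pattern_def length_decreasing_then_max)
  then show ?thesis using False by (simp only: N0_2_31_def) simp
qed

text \<open>The convention can only add the empty word, which has no prefix of length
  \<open>k\<close> and is therefore not yet counted.\<close>

lemma N_2_31_decreasing_then_max:
  assumes "k \<ge> 1"
  shows "N_2_31 (decreasing_then_max k) n =
    N0_2_31 (decreasing_then_max k) n + (if k = 1 \<and> n = 0 then 1 else 0)"
proof -
  have one: "decreasing_then_max k = [1] \<longleftrightarrow> k = 1"
  proof
    assume "decreasing_then_max k = [1]"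
    then show "k = 1" using length_decreasing_then_max[OF assms] by simp
  qed (simp add: decreasing_then_max_def)
  have Nil: "[] \<in> avoiders_2_31 n \<longleftrightarrow> n = 0"
    by (auto simp: avoiders_2_31_def permutations_of_set_def contains_2_31_Nil)
  define S where "S = {w \<in> avoiders_2_31 n. prefix_has_pattern w (decreasing_then_max k)}"
  have "finite S" by (simp add: S_def avoiders_2_31_def)
  moreover have "[] \<notin> S"
    using assms by (auto simp: S_def prefix_has_pattern_def length_decreasing_then_max)
  moreover have "{w \<in> avoiders_2_31 n. begins_with w (decreasing_then_max k)} =
      (if k = 1 \<and> n = 0 then insert [] S else S)"
    using one Nil by (auto simp: S_def begins_with_def)
  ultimately show ?thesis
    by (simp add: N_2_31_def N0_2_31_def S_def[symmetric])
qed

text \<open>By the convolution, squaring the Catalan series shifts its index by one: the coefficient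
  of x^m is \<open>catalan (Suc m)\<close>. Multiplying by x^k then gives the index n - k +
  1.\<close>

lemma fps_X_power_mult_catalan_fps_nth:
  assumes "k \<ge> 1"
  shows "fps_nth (fps_X ^ k * catalan_fps ^ 2) n = (if n \<ge> k then catalan (n - (k - 1)) else 0)"
proof -
  obtain l where k: "k = Suc l" using assms by (cases k) auto
  have "fps_nth (catalan_fps ^ 2) m = catalan (Suc m)" for m
    by (simp add: power2_eq_square fps_mult_nth catalan_fps_def atLeast0AtMost catalan_convolution)
  then show ?thesis
    by (auto simp: fps_X_power_mult_nth k Suc_diff_Suc Suc_le_eq simp del: power_Suc)
qed

text \<open>The formulas hold as they stand for the counts without the convention. With it, the case
  k = 1 gains the constant term 1, and by \<open>catalan_fps_eq\<close> the series is then C(x)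
  itself; for k > 1 the two counts agree.\<close>

theorem proposition25:
  fixes k :: nat
  assumes "k \<ge> 1"
  shows "G0_2_31 (decreasing_then_max k) = fps_X ^ k * catalan_fps ^ 2 \<and>
    (\<forall>n. real (N0_2_31 (decreasing_then_max k) n) =
      (if n \<ge> k then catalan (n - (k - 1)) else 0)) \<and>
    G_2_31 (decreasing_then_max k) =
      fps_X ^ k * catalan_fps ^ 2 + (if k = 1 then 1 else 0) \<and>
    (\<forall>n. real (N_2_31 (decreasing_then_max k) n) =
      (if n \<ge> k then catalan (n - (k - 1)) else 0) + (if k = 1 \<and> n = 0 then 1 else 0))"
proof -
  have N0: "real (N0_2_31 (decreasing_then_max k) n) =
      (if n \<ge> k then catalan (n - (k - 1)) else 0)" for n
    by (rule N0_2_31_decreasing_then_max[OF assms])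
  have N: "real (N_2_31 (decreasing_then_max k) n) =
      (if n \<ge> k then catalan (n - (k - 1)) else 0) + (if k = 1 \<and> n = 0 then 1 else 0)" for n
    by (simp add: N_2_31_decreasing_then_max[OF assms] N0)
  have "G0_2_31 (decreasing_then_max k) = fps_X ^ k * catalan_fps ^ 2"
    by (rule fps_ext)
      (simp only: G0_2_31_def fps_nth_Abs_fps N0 fps_X_power_mult_catalan_fps_nth[OF assms])
  moreover have "G_2_31 (decreasing_then_max k) =
      fps_X ^ k * catalan_fps ^ 2 + (if k = 1 then 1 else 0)"
  proof (rule fps_ext)
    fix n
    have "fps_nth (if k = 1 then 1 else 0 :: real fps) n = (if k = 1 \<and> n = 0 then 1 else 0)"
      by simp
    then show "fps_nth (G_2_31 (decreasing_then_max k)) n =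
        fps_nth (fps_X ^ k * catalan_fps ^ 2 + (if k = 1 then 1 else 0)) n"
      by (simp only: G_2_31_def fps_nth_Abs_fps N fps_add_nth
          fps_X_power_mult_catalan_fps_nth[OF assms])
  qed
  ultimately show ?thesis using N0 N by blast
qed

end
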